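(* Let $\beta\ge 1$, $\delta\in(0,1]$, and let $q(x)$ be a degree-$d$ polynomial which satisfies \[ |q(x)-\exp(\beta x)| \le 0.1 \ \text{ for } x\in[-1,0],\qquad\text{and}\qquad |q(x)|\le 1 \ \text{ for } x\in[0,\delta]. \] Then $d = \Omega(\beta\sqrt{\delta})$.
   Context: $d=\Omega(g)$ means $d \ge c\, g$ for a universal constant $c>0$ independent of $\beta,\delta,q$. *)

theory Defs
  imports Complex_Main "HOL-Computational_Algebra.Polynomial"
begin

end

theory Submission
  imports Defs
begin

text \<open>
  Since \<open>q\<close> falls by at least \<open>0.3\<close> from \<open>0\<close> to \<open>-1/\<beta>\<close>, its derivative is at least \<open>0.3 \<beta>\<close>
  somewhere in between, while \<open>q\<close> is bounded by \<open>1.1\<close> on \<open>[-1, \<delta>]\<close>; Bernstein's inequality on this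
  interval then bounds the degree from below (for \<open>\<beta> < 2\<close> it suffices that \<open>q\<close> is not constant).
  Bernstein's inequality, with a constant 2 too large, comes from the quadrature formula
  \<open>T'(x) = (\<Sum>k<3n. w\<^sub>k T(x + t\<^sub>k))\<close> for even trigonometric polynomials \<open>T\<close> of degree at most \<open>n\<close>,
  where \<open>t\<^sub>k = 2\<pi>k/3n\<close> and \<open>w\<^sub>k\<close> is a multiple of \<open>sin (n t\<^sub>k)\<close> times the nonnegative Fejer kernel at
  \<open>t\<^sub>k\<close>, so that \<open>(\<Sum>k<3n. \<bar>w\<^sub>k\<bar>) \<le> 2n\<close>.
\<close>

section \<open>Rearranging sums and product-to-sum identities\<close>

lemma sum_rotate:
  "(\<Sum>k\<in>K. \<Sum>a\<in>A. \<Sum>b\<in>B. f k a b) = (\<Sum>a\<in>A. \<Sum>b\<in>B. \<Sum>k\<in>K. f k a b)"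
proof -
  have "(\<Sum>k\<in>K. \<Sum>a\<in>A. \<Sum>b\<in>B. f k a b) = (\<Sum>a\<in>A. \<Sum>k\<in>K. \<Sum>b\<in>B. f k a b)"
    by (rule sum.swap)
  also have "\<dots> = (\<Sum>a\<in>A. \<Sum>b\<in>B. \<Sum>k\<in>K. f k a b)"
    by (rule sum.cong[OF refl]) (rule sum.swap)
  finally show ?thesis .
qed

text \<open>Splits a product of a sine, a cosine and a kernel term into single frequencies, which
  orthogonality at the nodes can evaluate; \<open>sin_sin_cos_sum\<close> does the same with two
  sines.\<close>

lemma sin_cos_cos_sum:
  fixes u v w :: real
  shows "sin (u + v + w) + sin (u + v - w) + sin (u - v + w) + sin (u - v - w) = 4 * (sin u * cos v) * cos w"
  by (simp add: sin_add sin_diff cos_add cos_diff algebra_simps)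

lemma sin_sin_cos_sum:
  fixes u v w :: real
  shows "cos (u - v + w) + cos (u - v - w) - cos (u + v + w) - cos (u + v - w) = 4 * (sin u * sin v) * cos w"
  by (simp add: sin_add sin_diff cos_add cos_diff algebra_simps)

section \<open>Orthogonality at equally spaced nodes\<close>

definition node :: "nat \<Rightarrow> nat \<Rightarrow> real" where
  "node N k = 2 * pi * real k / real N"

text \<open>A geometric sum over powers of an \<open>N\<close>-th root of unity \<open>w\<close>. If
  \<open>w = 1\<close>, then \<open>N\<close> divides \<open>j\<close>, and \<bar>j\<bar> < N leaves
  only \<open>j = 0\<close>.\<close>

lemma sum_cis_node:
  fixes j :: int
  assumes "\<bar>j\<bar> < int N"
  shows "(\<Sum>k<N. cis (of_int j * node N k)) = (if j = 0 then of_nat N else 0)"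
proof (cases "j = 0")
  case False
  define w where "w = cis (2 * pi * of_int j / real N)"
  have N: "N > 0" using assms by auto
  have pow: "cis (of_int j * node N k) = w ^ k" for k
    by (simp add: w_def node_def DeMoivre mult_ac)
  have "w ^ N = cis (2 * pi * of_int j)"
    using N by (simp add: w_def DeMoivre)
  also have "\<dots> = 1" by (rule cis_multiple_2pi) auto
  finally have wN: "w ^ N = 1" .
  have "w \<noteq> 1"
  proof
    assume "w = 1"
    then have "cos (2 * pi * of_int j / real N) = 1"
      by (simp add: w_def complex_eq_iff)
    then obtain i :: int where "2 * pi * of_int j / real N = of_int i * 2 * pi"
      by (auto simp: cos_one_2pi_int)
    then have "real_of_int j = real_of_int i * real N"
      using N by (simp add: field_simps)
    then have "j = i * int N"
      by (metis of_int_eq_iff of_int_mult of_int_of_nat_eq)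
    then show False
      using assms False by (auto simp: abs_mult mult_less_cancel_right2)
  qed
  then show ?thesis using False by (simp add: pow geometric_sum wN)
qed simp

lemma sum_cos_node:
  fixes j :: int
  assumes "\<bar>j\<bar> < int N"
  shows "(\<Sum>k<N. cos (of_int j * node N k)) = (if j = 0 then real N else 0)"
  using arg_cong[OF sum_cis_node[OF assms], of Re] by (simp split: if_splits)

lemma sum_sin_node:
  fixes j :: int
  assumes "\<bar>j\<bar> < int N"
  shows "(\<Sum>k<N. sin (of_int j * node N k)) = 0"
  using arg_cong[OF sum_cis_node[OF assms], of Im] by (simp split: if_splits)

section \<open>The Fejer kernel and the moments of the weights\<close>

text \<open>This is \<open>n\<close> times the usual Fejer kernel, the squared modulus of the sum of
  \<open>cis (a * t)\<close> over \<open>a < n\<close>. The double sum exposes its frequencies, all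
  of modulus at most \<open>n - 1\<close>.\<close>

definition fejer :: "nat \<Rightarrow> real \<Rightarrow> real" where
  "fejer n t = (\<Sum>a<n. \<Sum>b<n. cos (of_int (int a - int b) * t))"

lemma fejer_nonneg: "fejer n t \<ge> 0"
proof -
  have "fejer n t = (\<Sum>a<n. cos (a * t))\<^sup>2 + (\<Sum>a<n. sin (a * t))\<^sup>2"
    by (simp add: fejer_def power2_eq_square sum_product left_diff_distrib cos_diff sum.distrib)
  then show ?thesis by simp
qed

text \<open>Multiplying by a sine or cosine of frequency \<bar>m\<bar> \<le> n gives frequencies of
  modulus at most n + n + (n - 1) < 3n, so \<open>3 * n\<close> nodes avoid aliasing. The factor
  2/(3n) makes the \<open>m\<close>-th sine moment equal to \<open>m\<close>.\<close>

definition weight :: "nat \<Rightarrow> nat \<Rightarrow> real" where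
  "weight n k = 2 / real (3 * n) * sin (n * node (3 * n) k) * fejer n (node (3 * n) k)"

text \<open>The sine is at most 1 in modulus and the kernel is nonnegative. Summing the kernel over
  the nodes keeps only the \<open>n\<close> diagonal terms \<open>a = b\<close>, each worth
  \<open>3 * n\<close>.\<close>

lemma sum_abs_weight_le: "(\<Sum>k<3*n. \<bar>weight n k\<bar>) \<le> 2 * real n"
proof (cases "n = 0")
  case False
  have "(\<Sum>k<3*n. \<bar>weight n k\<bar>) \<le> (\<Sum>k<3*n. 2 / real (3 * n) * fejer n (node (3 * n) k))"
    unfolding weight_def abs_mult
    by (intro sum_mono mult_mono) (auto simp: fejer_nonneg divide_right_mono)
  also have "\<dots> = 2 / real (3 * n) * (\<Sum>k<3*n. fejer n (node (3 * n) k))"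
    by (simp add: sum_distrib_left)
  also have "(\<Sum>k<3*n. fejer n (node (3 * n) k)) =
      (\<Sum>a<n. \<Sum>b<n. \<Sum>k<3*n. cos (of_int (int a - int b) * node (3 * n) k))"
    unfolding fejer_def by (rule sum_rotate)
  also have "\<dots> = (\<Sum>a<n. \<Sum>b<n. if int a - int b = 0 then real (3 * n) else 0)"
    by (intro sum.cong refl sum_cos_node) auto
  also have "\<dots> = (\<Sum>a<n. real (3 * n))"
    by (intro sum.cong refl) (simp add: sum.delta')
  finally show ?thesis using False by (simp add: field_simps)
qed simp

text \<open>Every term of the expanded product is a sine of frequency below \<open>3 * n\<close> in
  modulus, and these sum to 0 over the nodes.\<close>

lemma sum_weight_cos:
  fixes m :: int
  assumes "\<bar>m\<bar> \<le> int n"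
  shows "(\<Sum>k<3*n. weight n k * cos (of_int m * node (3 * n) k)) = 0"
proof -
  let ?t = "node (3 * n)"
  have eq: "weight n k * cos (of_int m * ?t k) = 1 / (2 * real (3 * n)) * (\<Sum>a<n. \<Sum>b<n.
      sin (of_int (int n + m + (int a - int b)) * ?t k) + sin (of_int (int n + m - (int a - int b)) * ?t k)
    + sin (of_int (int n - m + (int a - int b)) * ?t k) + sin (of_int (int n - m - (int a - int b)) * ?t k))" for k
  proof -
    have "sin (of_int (int n + m + j) * ?t k) + sin (of_int (int n + m - j) * ?t k)
       + sin (of_int (int n - m + j) * ?t k) + sin (of_int (int n - m - j) * ?t k)
       = 4 * (sin (n * ?t k) * cos (of_int m * ?t k)) * cos (of_int j * ?t k)" for j
    proof -
      let ?u = "n * ?t k" and ?v = "of_int m * ?t k" and ?w = "of_int j * ?t k"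
      have "of_int (int n + m + j) * ?t k = ?u + ?v + ?w" "of_int (int n + m - j) * ?t k = ?u + ?v - ?w"
        "of_int (int n - m + j) * ?t k = ?u - ?v + ?w" "of_int (int n - m - j) * ?t k = ?u - ?v - ?w"
        by (simp_all add: algebra_simps)
      then show ?thesis by (simp only: sin_cos_cos_sum)
    qed
    then show ?thesis
      unfolding weight_def fejer_def by (simp only: sum_distrib_left[symmetric]) simp
  qed
  have "(\<Sum>k<3*n. weight n k * cos (of_int m * ?t k)) = 1 / (2 * real (3 * n)) * (\<Sum>a<n. \<Sum>b<n. \<Sum>k<3*n.
      sin (of_int (int n + m + (int a - int b)) * ?t k) + sin (of_int (int n + m - (int a - int b)) * ?t k)
    + sin (of_int (int n - m + (int a - int b)) * ?t k) + sin (of_int (int n - m - (int a - int b)) * ?t k))"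
    unfolding eq sum_distrib_left[symmetric] by (subst sum_rotate) (rule refl)
  also have "\<dots> = 1 / (2 * real (3 * n)) * (\<Sum>a<n. \<Sum>b<n. 0)"
    using assms
    by (intro arg_cong2[where f = "(*)"] sum.cong refl,
        simp only: sum.distrib, subst (1 2 3 4) sum_sin_node) auto
  finally show ?thesis by simp
qed

text \<open>The expanded product consists of cosines, of which only those of frequency 0 survive;
  counting the pairs \<open>(a, b)\<close> that produce them gives \<open>m\<close>, twice.\<close>

lemma sum_weight_sin_nonneg:
  assumes "m \<le> n"
  shows "(\<Sum>k<3*n. weight n k * sin (real m * node (3 * n) k)) = real m"
proof (cases "n = 0")
  case False
  let ?t = "node (3 * n)"
  have eq: "weight n k * sin (real m * ?t k) = 1 / (2 * real (3 * n)) * (\<Sum>a<n. \<Sum>b<n.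
      cos (of_int (int n - m + (int a - int b)) * ?t k) + cos (of_int (int n - m + (int b - int a)) * ?t k)
    - cos (of_int (int n + m + (int a - int b)) * ?t k) - cos (of_int (int n + m - (int a - int b)) * ?t k))" for k
  proof -
    have "cos (of_int (int n - m + (a - b)) * ?t k) + cos (of_int (int n - m + (b - a)) * ?t k)
       - cos (of_int (int n + m + (a - b)) * ?t k) - cos (of_int (int n + m - (a - b)) * ?t k)
       = 4 * (sin (n * ?t k) * sin (real m * ?t k)) * cos (of_int (a - b) * ?t k)" for a b
    proof -
      let ?u = "n * ?t k" and ?v = "m * ?t k" and ?w = "of_int (a - b) * ?t k"
      have "of_int (int n - m + (a - b)) * ?t k = ?u - ?v + ?w" "of_int (int n - m + (b - a)) * ?t k = ?u - ?v - ?w"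
        "of_int (int n + m + (a - b)) * ?t k = ?u + ?v + ?w" "of_int (int n + m - (a - b)) * ?t k = ?u + ?v - ?w"
        by (simp_all add: algebra_simps)
      then show ?thesis by (simp only: sin_sin_cos_sum)
    qed
    then show ?thesis
      unfolding weight_def fejer_def by (simp only: sum_distrib_left[symmetric]) simp
  qed
  have "(\<Sum>k<3*n. weight n k * sin (real m * ?t k)) = 1 / (2 * real (3 * n)) * (\<Sum>a<n. \<Sum>b<n. \<Sum>k<3*n.
      cos (of_int (int n - m + (int a - int b)) * ?t k) + cos (of_int (int n - m + (int b - int a)) * ?t k)
    - cos (of_int (int n + m + (int a - int b)) * ?t k) - cos (of_int (int n + m - (int a - int b)) * ?t k))"
    unfolding eq sum_distrib_left[symmetric] by (subst sum_rotate) (rule refl)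
  \<comment> \<open>The subtracted cosines have frequency at least n + m - (n - 1) \<ge> 1, so they
    sum to 0.\<close>
  also have "\<dots> = 1 / (2 * real (3 * n)) * (\<Sum>a<n. \<Sum>b<n.
      (if int n - m + (int a - int b) = 0 then real (3 * n) else 0)
    + (if int n - m + (int b - int a) = 0 then real (3 * n) else 0))"
    using assms
    by (intro arg_cong2[where f = "(*)"] sum.cong refl,
        simp only: sum.distrib sum_subtractf, subst (1 2 3 4) sum_cos_node) auto
  also have "(\<Sum>a<n. \<Sum>b<n.
      (if int n - m + (int a - int b) = 0 then real (3 * n) else 0)
    + (if int n - m + (int b - int a) = 0 then real (3 * n) else 0))
    = 2 * (\<Sum>a<n. \<Sum>b<n. if int n - m + (int a - int b) = 0 then real (3 * n) else 0)"
    by (simp add: sum.distrib) (rule sum.swap)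
  \<comment> \<open>For fixed \<open>a\<close> the only solution is \<open>b = n - m + a\<close>,
    which is below \<open>n\<close> exactly when \<open>a < m\<close>.\<close>
  also have "(\<Sum>a<n. \<Sum>b<n. if int n - m + (int a - int b) = 0 then real (3 * n) else 0)
    = (\<Sum>a<n. if a < m then real (3 * n) else 0)"
  proof (intro sum.cong refl)
    fix a assume "a \<in> {..<n}"
    have "(\<Sum>b<n. if int n - m + (int a - int b) = 0 then real (3 * n) else 0)
        = (\<Sum>b<n. if b = n - m + a then real (3 * n) else 0)"
      using assms by (intro sum.cong refl) auto
    also have "\<dots> = (if a < m then real (3 * n) else 0)"
      using assms by auto
    finally show "(\<Sum>b<n. if int n - m + (int a - int b) = 0 then real (3 * n) else 0) = \<dots>" .
  qed
  also have "\<dots> = real m * real (3 * n)"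
  proof -
    have "(\<Sum>a<n. if a < m then real (3 * n) else 0) = (\<Sum>a<m. real (3 * n))"
      using assms by (intro sum.mono_neutral_cong_right) auto
    then show ?thesis by simp
  qed
  finally show ?thesis using False by simp
qed (use assms in simp)

lemma sum_weight_sin:
  fixes m :: int
  assumes "\<bar>m\<bar> \<le> int n"
  shows "(\<Sum>k<3*n. weight n k * sin (of_int m * node (3 * n) k)) = of_int m"
proof (cases "m \<ge> 0")
  case True
  then show ?thesis using sum_weight_sin_nonneg[of "nat m" n] assms by simp
next
  case False
  then show ?thesis
    using sum_weight_sin_nonneg[of "nat (- m)" n] assms by (simp add: sum_negf)
qed

section \<open>The quadrature formula for derivatives\<close>

text \<open>The right-hand side is the derivative of \<open>cos (m * x)\<close>. The addition
  formula reduces the sum to the cosine moment 0 and the sine moment \<open>m\<close>.\<close>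

lemma sum_weight_cos_shift:
  fixes m :: int
  assumes "\<bar>m\<bar> \<le> int n"
  shows "(\<Sum>k<3*n. weight n k * cos (of_int m * (x + node (3 * n) k))) = - of_int m * sin (of_int m * x)"
proof -
  have "weight n k * cos (of_int m * (x + node (3 * n) k)) =
      cos (of_int m * x) * (weight n k * cos (of_int m * node (3 * n) k))
    - sin (of_int m * x) * (weight n k * sin (of_int m * node (3 * n) k))" for k
    by (simp add: distrib_left cos_add algebra_simps)
  then show ?thesis
    by (simp add: sum_subtractf sum_weight_cos sum_weight_sin assms flip: sum_distrib_left)
qed

text \<open>The binomial theorem for the \<open>j\<close>-th power of
  \<open>(cis x + cis (- x)) / 2\<close>. All frequencies have modulus at most \<open>j\<close>, so
  the quadrature formula applies termwise whenever j \<le> n.\<close>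

lemma cos_power_expansion:
  "cos x ^ j = (\<Sum>l\<le>j. real (j choose l) / 2 ^ j * cos (of_int (2 * int l - int j) * x))"
proof -
  have "complex_of_real (cos x) = (cis x + cis (- x)) / 2"
    by (simp add: complex_eq_iff)
  then have "complex_of_real (cos x ^ j) = (cis x + cis (- x)) ^ j / 2 ^ j"
    by (simp only: of_real_power power_divide)
  also have "(cis x + cis (- x)) ^ j = (\<Sum>l\<le>j. of_nat (j choose l) * cis (of_int (2 * int l - int j) * x))"
    unfolding binomial_ring
  proof (intro sum.cong refl)
    fix l assume "l \<in> {..j}"
    then have "real l * x + real (j - l) * (- x) = of_int (2 * int l - int j) * x"
      by (simp add: of_nat_diff algebra_simps)
    then show "of_nat (j choose l) * cis x ^ l * cis (- x) ^ (j - l)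
        = of_nat (j choose l) * cis (of_int (2 * int l - int j) * x)"
      by (simp only: DeMoivre mult.assoc cis_mult)
  qed
  finally have "Re (complex_of_real (cos x ^ j)) =
    Re ((\<Sum>l\<le>j. of_nat (j choose l) * cis (of_int (2 * int l - int j) * x)) / 2 ^ j)" by simp
  also have "\<dots> = (\<Sum>l\<le>j. real (j choose l) * cos (of_int (2 * int l - int j) * x)) / 2 ^ j"
  proof -
    have "Re (z / 2 ^ j) = Re z / 2 ^ j" for z
      using Re_divide_of_real[of z "2 ^ j"] by simp
    then show ?thesis by simp
  qed
  finally show ?thesis by (simp add: sum_divide_distrib)
qed

lemma has_derivative_cos_power_weight:
  assumes "j \<le> n"
  shows "((\<lambda>x. cos x ^ j) has_real_derivative (\<Sum>k<3*n. weight n k * cos (x + node (3 * n) k) ^ j)) (at x)"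
proof -
  let ?A = "\<lambda>l. real (j choose l) / 2 ^ j"
  let ?m = "\<lambda>l. 2 * int l - int j"
  have "((\<lambda>x. \<Sum>l\<le>j. ?A l * cos (of_int (?m l) * x)) has_real_derivative
      (\<Sum>l\<le>j. ?A l * (- of_int (?m l) * sin (of_int (?m l) * x)))) (at x)"
    by (intro DERIV_sum DERIV_cmult) (auto intro!: derivative_eq_intros simp: algebra_simps)
  also have "(\<Sum>l\<le>j. ?A l * (- of_int (?m l) * sin (of_int (?m l) * x))) =
      (\<Sum>l\<le>j. ?A l * (\<Sum>k<3*n. weight n k * cos (of_int (?m l) * (x + node (3 * n) k))))"
    using assms by (intro sum.cong refl arg_cong2[where f = "(*)"] sum_weight_cos_shift[symmetric]) auto
  also have "\<dots> = (\<Sum>k<3*n. weight n k * cos (x + node (3 * n) k) ^ j)"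
    unfolding cos_power_expansion sum_distrib_left
    by (subst sum.swap) (simp add: mult_ac)
  finally show ?thesis by (simp only: cos_power_expansion)
qed

lemma has_derivative_poly_cos_weight:
  fixes p :: "real poly"
  assumes "degree p \<le> n"
  shows "((\<lambda>x. poly p (cos x)) has_real_derivative
    (\<Sum>k<3*n. weight n k * poly p (cos (x + node (3 * n) k)))) (at x)"
proof -
  have "((\<lambda>x. \<Sum>j\<le>degree p. coeff p j * cos x ^ j) has_real_derivative
      (\<Sum>j\<le>degree p. coeff p j * (\<Sum>k<3*n. weight n k * cos (x + node (3 * n) k) ^ j))) (at x)"
    using assms by (intro DERIV_sum DERIV_cmult has_derivative_cos_power_weight) auto
  also have "(\<Sum>j\<le>degree p. coeff p j * (\<Sum>k<3*n. weight n k * cos (x + node (3 * n) k) ^ j)) =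
      (\<Sum>k<3*n. weight n k * poly p (cos (x + node (3 * n) k)))"
    unfolding poly_altdef sum_distrib_left
    by (subst sum.swap) (simp add: mult_ac)
  finally show ?thesis by (simp only: poly_altdef)
qed

section \<open>Bernstein's inequality\<close>

text \<open>Up to sign, the left side is the derivative of \<open>poly p (cos x)\<close>, which the
  quadrature formula writes as a weighted sum of values of \<open>p\<close> on [-1, 1].\<close>

lemma bernstein_weak_cos:
  fixes p :: "real poly"
  assumes "\<And>y. \<bar>y\<bar> \<le> 1 \<Longrightarrow> \<bar>poly p y\<bar> \<le> M"
  shows "\<bar>poly (pderiv p) (cos x) * sin x\<bar> \<le> 2 * real (degree p) * M"
proof -
  let ?n = "degree p"
  let ?S = "\<Sum>k<3*?n. weight ?n k * poly p (cos (x + node (3 * ?n) k))"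
  have "((\<lambda>x. poly p (cos x)) has_real_derivative poly (pderiv p) (cos x) * (- sin x)) (at x)"
    by (rule DERIV_chain2[OF poly_DERIV]) (auto intro!: derivative_eq_intros)
  then have "poly (pderiv p) (cos x) * (- sin x) = ?S"
    using has_derivative_poly_cos_weight[OF order_refl] by (rule DERIV_unique)
  then have "\<bar>poly (pderiv p) (cos x) * sin x\<bar> = \<bar>?S\<bar>"
    by (metis abs_minus_cancel mult_minus_right)
  also have "\<dots> \<le> (\<Sum>k<3*?n. \<bar>weight ?n k\<bar> * M)"
    by (rule order_trans[OF sum_abs]) (auto simp: abs_mult intro!: sum_mono mult_left_mono assms)
  also have "\<dots> \<le> 2 * real ?n * M"
  proof -
    have "M \<ge> 0" using assms[of 0] by simp
    then show ?thesis
      using sum_abs_weight_le[of ?n] by (simp add: mult_right_mono flip: sum_distrib_right)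
  qed
  finally show ?thesis .
qed

text \<open>Transfer by the affine map u \<mapsto> B + A u from [-1, 1] onto [a, b]. At the angle
  \<open>arccos u\<close> the sine is \<open>sqrt (1 - u^2)\<close>, and the chain rule factor
  \<open>A\<close> turns it into \<open>sqrt ((x - a) * (b - x))\<close>.\<close>

lemma bernstein_weak:
  fixes p :: "real poly"
  assumes bound: "\<And>y. y \<in> {a..b} \<Longrightarrow> \<bar>poly p y\<bar> \<le> M"
    and x: "x \<in> {a<..<b}"
  shows "\<bar>poly (pderiv p) x\<bar> * sqrt ((x - a) * (b - x)) \<le> 2 * real (degree p) * M"
proof -
  define A B where "A = (b - a) / 2" and "B = (a + b) / 2"
  have A: "A > 0" using x by (simp add: A_def)
  let ?P = "p \<circ>\<^sub>p [:B, A:]"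
  let ?u = "(x - B) / A"
  have u: "\<bar>?u\<bar> \<le> 1" using x A by (auto simp: abs_le_iff field_simps A_def B_def)
  have "\<bar>poly ?P y\<bar> \<le> M" if "\<bar>y\<bar> \<le> 1" for y
  proof -
    have "A * y \<le> A" "- A \<le> A * y"
      using that A mult_left_mono[of y 1 A] mult_left_mono[of "-1" y A] by auto
    then have "B + y * A \<in> {a..b}" by (auto simp: A_def B_def field_simps)
    then show ?thesis using bound by (simp add: poly_pcompose)
  qed
  from bernstein_weak_cos[of ?P M "arccos ?u", OF this]
  have "\<bar>poly (pderiv p) x * A * sqrt (1 - ?u\<^sup>2)\<bar> \<le> 2 * real (degree p) * M"
    using A u by (simp add: mult_ac degree_pcompose pderiv_pcompose poly_pcompose cos_arccos_abs sin_arccos_abs pderiv_pCons)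
  also have "poly (pderiv p) x * A * sqrt (1 - ?u\<^sup>2) = poly (pderiv p) x * sqrt (A\<^sup>2 * (1 - ?u\<^sup>2))"
    using A by (simp add: real_sqrt_mult)
  also have "A\<^sup>2 * (1 - ?u\<^sup>2) = (x - a) * (b - x)"
  proof -
    have "A\<^sup>2 * (1 - ?u\<^sup>2) = A\<^sup>2 - (x - B)\<^sup>2" using A by (simp add: field_simps)
    also have "\<dots> = (x - a) * (b - x)"
      by (simp add: A_def B_def power2_eq_square field_simps)
    finally show ?thesis .
  qed
  finally show ?thesis using x by (simp add: abs_mult)
qed

section \<open>The lower bound on the degree\<close>

theorem corollary29:
  "\<exists>c::real. c > 0 \<and>
     (\<forall>(\<beta>::real) (\<delta>::real) (q::real poly) (d::nat).
        \<beta> \<ge> 1 \<longrightarrow> \<delta> \<in> {0<..1} \<longrightarrow> degree q = d \<longrightarrow>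
        (\<forall>x\<in>{-1..0}. \<bar>poly q x - exp (\<beta> * x)\<bar> \<le> 0.1) \<longrightarrow>
        (\<forall>x\<in>{0..\<delta>}. \<bar>poly q x\<bar> \<le> 1) \<longrightarrow>
        real d \<ge> c * (\<beta> * sqrt \<delta>))"
\<comment> \<open>The case \<beta> < 2 allows any constant up to 1/2, the case \<beta> \<ge> 2 any
  up to 0.15/2.2, which exceeds 1/20.\<close>
proof (intro exI[of _ "1/20"] conjI allI impI)
  fix \<beta> \<delta> :: real and q :: "real poly" and d :: nat
  assume \<beta>: "\<beta> \<ge> 1" and \<delta>: "\<delta> \<in> {0<..1}" and d: "degree q = d"
    and approx: "\<forall>x\<in>{-1..0}. \<bar>poly q x - exp (\<beta> * x)\<bar> \<le> 0.1"
    and bdd: "\<forall>x\<in>{0..\<delta>}. \<bar>poly q x\<bar> \<le> 1"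
  have "exp (-1) \<le> (1/2 :: real)"
    using exp_ge_add_one_self[of "1::real"] by (simp add: exp_minus field_simps)
  moreover have "\<bar>poly q (- 1 / \<beta>) - exp (-1)\<bar> \<le> 0.1" "\<bar>poly q 0 - 1\<bar> \<le> 0.1"
    using approx[rule_format, of "- 1 / \<beta>"] approx[rule_format, of 0] \<beta> by auto
  \<comment> \<open>At 0 the value is at least 0.9, at -1/\<beta> at most 1/2 + 0.1.\<close>
  ultimately have drop: "poly q 0 - poly q (- 1 / \<beta>) \<ge> 0.3" by linarith
  have s1: "sqrt \<delta> \<le> 1" using \<delta> by simp
  show "real d \<ge> 1/20 * (\<beta> * sqrt \<delta>)"
  \<comment> \<open>For \<beta> \<ge> 2 the interval from -1/\<beta> to 0 stays at distance at least
    1/2 from the endpoint -1, where the Bernstein factor degenerates.\<close>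
  proof (cases "\<beta> \<ge> 2")
    case False
    have "d \<noteq> 0"
    proof
      assume "d = 0"
      then obtain a where "q = [:a:]" using d degree_eq_zeroE by blast
      then show False using drop by simp
    qed
    moreover have "\<beta> * sqrt \<delta> \<le> 2 * 1"
      using False \<beta> \<delta> s1 by (intro mult_mono) auto
    ultimately show ?thesis by linarith
  next
    case True
    obtain x where x: "- 1 / \<beta> < x" "x < 0"
      and dx: "poly q 0 - poly q (- 1 / \<beta>) = (0 - - 1 / \<beta>) * poly (pderiv q) x"
      using poly_MVT[of "- 1 / \<beta>" 0 q] \<beta> by auto
    have deriv: "0.3 * \<beta> \<le> poly (pderiv q) x"
      using drop \<beta> unfolding dx by (simp add: field_simps)
    have "- 1 / \<beta> \<ge> - 1 / 2" using True by (simp add: field_simps)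
    with x have x': "x > - 1 / 2" by linarith
    have "\<bar>poly q y\<bar> \<le> 1.1" if "y \<in> {-1..\<delta>}" for y
    proof (cases "y \<le> 0")
      case True
      then have "exp (\<beta> * y) \<le> 1" using \<beta> by (simp add: mult_nonneg_nonpos)
      moreover have "\<bar>poly q y - exp (\<beta> * y)\<bar> \<le> 0.1" using approx that True by auto
      ultimately show ?thesis using exp_gt_zero[of "\<beta> * y"] by linarith
    next
      case False
      then have "\<bar>poly q y\<bar> \<le> 1" using bdd that by auto
      then show ?thesis by simp
    qed
    then have bern: "\<bar>poly (pderiv q) x\<bar> * sqrt ((x - - 1) * (\<delta> - x)) \<le> 2 * real d * 1.1"
      unfolding d[symmetric] using x x' \<delta> by (intro bernstein_weak) auto
    \<comment> \<open>Here x + 1 > 1/2 and, as x < 0, \<delta> - x > \<delta>; the weaker constant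
      1/4 has a rational square root.\<close>
    have "1/4 * \<delta> \<le> (x - - 1) * (\<delta> - x)"
      using x x' \<delta> by (intro mult_mono) auto
    then have "sqrt (1/4 * \<delta>) \<le> sqrt ((x - - 1) * (\<delta> - x))" by simp
    then have "1/2 * sqrt \<delta> \<le> sqrt ((x - - 1) * (\<delta> - x))"
      by (simp add: real_sqrt_mult real_sqrt_divide)
    then have "(0.3 * \<beta>) * (1/2 * sqrt \<delta>) \<le> \<bar>poly (pderiv q) x\<bar> * sqrt ((x - - 1) * (\<delta> - x))"
      using deriv \<beta> \<delta> by (intro mult_mono) auto
    with bern show ?thesis by simp
  qed
qed simp

end
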